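(* Let $(\mathcal{C},\lambda)$ be a $(2n+1)$-dimensional contact manifold with canonical coordinates $(x,p,z)$, $\lambda=dz-p_a\,dx^a$, let $\varphi$ be a function of $p$ only, and let $\mathcal{A}_\varphi$ be the Legendre submanifold generated by $-\varphi$. Let $F_1,\dots,F_n$ be functions of $p$ on $\mathcal{A}_\varphi$ which do not identically vanish, and consider on $\mathcal{A}_\varphi$ the vector field $\check X=\dot p_a\,\partial/\partial p_a$, $\dot p_a=F_a(p)$. Let $\Gamma$ be a function of one variable. Then the flow of $\check X$ is lifted to $\mathcal{C}$ as the flow of the vector field $X_h=\dot x^a\frac{\partial}{\partial x^a}+\dot p_a\frac{\partial}{\partial p_a}+\dot z\frac{\partial}{\partial z}$ whose components satisfy $$\frac{d\Delta^a}{dt}=-\frac{\partial F_b}{\partial p_a}\Delta^b-\frac{d\Gamma}{d\Delta^0}\Delta^a,\qquad \frac{dp_a}{dt}=F_a(p),\qquad \frac{d\Delta^0}{dt}=-\Gamma(\Delta^0),$$ and this $X_h$ is the contact Hamiltonian vector field associated to the contact Hamiltonian $$h(x,p,z)=\Delta^a(x,p)F_a(p)+\Gamma(\Delta^0(x,p,z)).$$ In addition, if $\Gamma(0)=0$ and $\Gamma(s)\neq0$ for $s\neq0$, then $X^0:=X_h|_{\Delta^0=\Delta^1=\dots=\Delta^n=0}$ is tangent to $\mathcal{A}_\varphi^{\mathcal{C}}$, and $\pi_*X_h=\check X$, $\Phi_*\check X=X^0$.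
   Context: All objects are smooth, repeated indices are summed over $1,\dots,n$, and everything is expressed in the canonical coordinates $(x,p,z)$. Put $\Delta^0(x,p,z)=x^jp_j-\varphi(p)-z$ and $\Delta^a(x,p)=x^a-\frac{\partial\varphi}{\partial p_a}(p)$. The Legendre submanifold $\mathcal{A}_\varphi$ generated by $-\varphi$ is parametrized by $p$; $\Phi:\mathcal{A}_\varphi\to\mathcal{C}$, $p\mapsto(\partial\varphi/\partial p,\,p,\,p_i\,\partial\varphi/\partial p_i-\varphi(p))$ is its embedding, with image $\mathcal{A}_\varphi^{\mathcal{C}}=\{\Delta^0=\Delta^1=\dots=\Delta^n=0\}$; and $\pi:\mathcal{C}\to\mathcal{A}_\varphi$ is the projection $\pi(x,p,z)=p$. A flow $\Phi^{\mathcal{N}}_t$ on $\mathcal{N}$ is a lift of a flow $\Phi^{\mathcal{M}}_t$ on $\mathcal{M}$ along a projection $\pi:\mathcal{N}\to\mathcal{M}$ ($\dim\mathcal{M}<\dim\mathcal{N}$) if $\Phi^{\mathcal{M}}_t\circ\pi=\pi\circ\Phi^{\mathcal{N}}_t$; here $\mathcal{N}=\mathcal{C}$, $\mathcal{M}=\mathcal{A}_\varphi$. The contact Hamiltonian vector field $X_h$ of a function $h$ is defined by $\iota_{X_h}\lambda=h$, $\iota_{X_h}d\lambda=-(dh-(\mathcal{R}h)\lambda)$ with $\mathcal{R}=\partial/\partial z$; in coordinates $\dot x^a=-\partial h/\partial p_a$, $\dot p_a=\partial h/\partial x^a+p_a\,\partial h/\partial z$, $\dot z=h-p_a\,\partial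 h/\partial p_a$. *)

theory Defs
  imports "HOL-Analysis.Analysis"
begin

section \<open>Smooth maps, derivatives of functions and of one-forms\<close>

text \<open>\<open>ck_on k S f\<close>: all derivatives of \<open>f\<close> up to order \<open>k\<close> exist and are continuous on the
  open set \<open>S\<close>.  A map is smooth if this holds for every \<open>k\<close>.\<close>

primrec ck_on :: "nat \<Rightarrow> 'a set \<Rightarrow> ('a::real_normed_vector \<Rightarrow> 'b::real_normed_vector) \<Rightarrow> bool"
where
  "ck_on 0 S f \<longleftrightarrow> continuous_on S f"
| "ck_on (Suc k) S f \<longleftrightarrow>
     (\<forall>x\<in>S. f differentiable (at x)) \<and> (\<forall>v. ck_on k S (\<lambda>x. frechet_derivative f (at x) v))"

definition smooth_on :: "'a set \<Rightarrow> ('a::real_normed_vector \<Rightarrow> 'b::real_normed_vector) \<Rightarrow> bool"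
  where "smooth_on S f \<longleftrightarrow> (\<forall>k. ck_on k S f)"

definition partial_diff :: "'n \<Rightarrow> (real^'n \<Rightarrow> real) \<Rightarrow> real^'n \<Rightarrow> real"
  where "partial_diff a f p = frechet_derivative f (at p) (axis a 1)"

text \<open>The derivative \<open>X(f)\<close> of a function along a vector field; this is \<open>df/dt\<close> along the
  integral curves of \<open>X\<close>.\<close>

definition lie_derivative ::
    "('a::real_normed_vector \<Rightarrow> 'a) \<Rightarrow> ('a \<Rightarrow> real) \<Rightarrow> 'a \<Rightarrow> real"
  where "lie_derivative X f y = frechet_derivative f (at y) (X y)"

text \<open>A one-form is given as \<open>\<alpha> y v\<close>, with base point \<open>y\<close> and tangent vector \<open>v\<close>.  The exterior
  derivative is normalised without the factor \<open>1/2\<close>, i.e.\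
  \<open>d\<alpha>(V,W) = V(\<alpha>(W)) - W(\<alpha>(V))\<close> for constant \<open>V\<close>, \<open>W\<close>.\<close>

definition exterior_derivative ::
    "('a::real_normed_vector \<Rightarrow> 'a \<Rightarrow> real) \<Rightarrow> 'a \<Rightarrow> 'a \<Rightarrow> 'a \<Rightarrow> real"
  where "exterior_derivative \<alpha> y v w =
    frechet_derivative (\<lambda>q. \<alpha> q w) (at y) v - frechet_derivative (\<lambda>q. \<alpha> q v) (at y) w"


section \<open>Flows, lifts, push-forwards and tangency\<close>

definition integral_curve ::
    "('a::real_normed_vector \<Rightarrow> 'a) \<Rightarrow> 'a set \<Rightarrow> real set \<Rightarrow> (real \<Rightarrow> 'a) \<Rightarrow> bool"
  where "integral_curve X S I c \<longleftrightarrow> open I \<and> is_interval I \<and> 0 \<in> I \<and>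
    (\<forall>t\<in>I. c t \<in> S \<and> (c has_vector_derivative X (c t)) (at t))"

text \<open>Vector fields need not be complete, so the flow is the maximal local one: \<open>flow_domain X S y\<close>
  is the maximal interval of existence for the initial point \<open>y\<close>.  For a smooth vector field on an
  open set, uniqueness of integral curves makes \<open>flow\<close> well defined on it.\<close>

definition flow_domain :: "('a::real_normed_vector \<Rightarrow> 'a) \<Rightarrow> 'a set \<Rightarrow> 'a \<Rightarrow> real set"
  where "flow_domain X S y = \<Union>{I. \<exists>c. integral_curve X S I c \<and> c 0 = y}"

definition flow :: "('a::real_normed_vector \<Rightarrow> 'a) \<Rightarrow> 'a set \<Rightarrow> real \<Rightarrow> 'a \<Rightarrow> 'a"
  where "flow X S t y =
    (THE w. \<exists>I c. integral_curve X S I c \<and> c 0 = y \<and> t \<in> I \<and> c t = w)"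

text \<open>The flow of \<open>Y\<close> on \<open>N\<close> is a lift of the flow of \<open>X\<close> on \<open>M\<close> along \<open>proj : N \<rightarrow> M\<close>:
  \<open>flow X M t \<circ> proj = proj \<circ> flow Y N t\<close> wherever the flow on \<open>N\<close> is defined.\<close>

definition flow_lift ::
    "('b::euclidean_space \<Rightarrow> 'a::euclidean_space) \<Rightarrow>
     'b set \<Rightarrow> ('b \<Rightarrow> 'b) \<Rightarrow> 'a set \<Rightarrow> ('a \<Rightarrow> 'a) \<Rightarrow> bool"
  where "flow_lift proj N Y M X \<longleftrightarrow> proj ` N = M \<and> DIM('a) < DIM('b) \<and>
    (\<forall>y\<in>N. \<forall>t\<in>flow_domain Y N y.
       t \<in> flow_domain X M (proj y) \<and> flow X M t (proj y) = proj (flow Y N t y))"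

text \<open>\<open>f\<^sub>* X = Y\<close>, where \<open>X\<close> is a vector field on \<open>S\<close> and \<open>Y\<close> one on \<open>f ` S\<close>.\<close>

definition pushes_forward ::
    "('a::real_normed_vector \<Rightarrow> 'b::real_normed_vector) \<Rightarrow>
     'a set \<Rightarrow> ('a \<Rightarrow> 'a) \<Rightarrow> ('b \<Rightarrow> 'b) \<Rightarrow> bool"
  where "pushes_forward f S X Y \<longleftrightarrow> (\<forall>y\<in>S. frechet_derivative f (at y) (X y) = Y (f y))"

text \<open>Velocities at \<open>y\<close> of smooth curves that run inside \<open>A\<close>.\<close>

definition tangent_vectors :: "'a::real_normed_vector set \<Rightarrow> 'a \<Rightarrow> 'a set"
  where "tangent_vectors A y = {v. \<exists>c e. e > 0 \<and> smooth_on {-e<..<e} c \<and> c ` {-e<..<e} \<subseteq> A \<and>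
    c 0 = y \<and> (c has_vector_derivative v) (at (0::real))}"

definition tangent_to :: "('a::real_normed_vector \<Rightarrow> 'a) \<Rightarrow> 'a set \<Rightarrow> bool"
  where "tangent_to X A \<longleftrightarrow> (\<forall>y\<in>A. X y \<in> tangent_vectors A y)"


section \<open>Contact geometry in canonical coordinates\<close>

text \<open>Points (and tangent vectors) in canonical coordinates \<open>(x, p, z)\<close>.\<close>

type_synonym 'n contact_point = "(real^'n) \<times> (real^'n) \<times> real"

definition proj_p :: "'n contact_point \<Rightarrow> real^'n"
  where "proj_p = (\<lambda>(x, p, z). p)"

text \<open>\<open>\<lambda> = dz - p\<^sub>a dx\<^sup>a\<close>.\<close>

definition contact_form :: "'n::finite contact_point \<Rightarrow> 'n contact_point \<Rightarrow> real"
  where "contact_form = (\<lambda>(x, p, z) (u, q, s). s - (\<Sum>a\<in>UNIV. p $ a * u $ a))"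

text \<open>\<open>\<R> = \<partial>/\<partial>z\<close>.\<close>

definition reeb :: "'n::finite contact_point \<Rightarrow> 'n contact_point"
  where "reeb y = (0, 0, 1)"

text \<open>\<open>X\<close> is the contact Hamiltonian vector field of \<open>h\<close> on \<open>C\<close>: \<open>\<iota>\<^sub>X \<lambda> = h\<close> and
  \<open>\<iota>\<^sub>X d\<lambda> = -(dh - (\<R>h) \<lambda>)\<close>.\<close>

definition contact_hamiltonian_vf ::
    "'n::finite contact_point set \<Rightarrow> ('n contact_point \<Rightarrow> real) \<Rightarrow>
     ('n contact_point \<Rightarrow> 'n contact_point) \<Rightarrow> bool"
  where "contact_hamiltonian_vf C h X \<longleftrightarrow> (\<forall>y\<in>C.
    contact_form y (X y) = h y \<and>
    (\<forall>w. exterior_derivative contact_form y (X y) w =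
         - (frechet_derivative h (at y) w - lie_derivative reeb h y * contact_form y w)))"

text \<open>\<open>Delta0 \<phi>\<close> and \<open>Delta \<phi> a\<close> are the functions \<open>\<Delta>\<^sup>0\<close> and \<open>\<Delta>\<^sup>a\<close>.\<close>

definition Delta0 :: "(real^'n \<Rightarrow> real) \<Rightarrow> 'n::finite contact_point \<Rightarrow> real"
  where "Delta0 \<phi> = (\<lambda>(x, p, z). (\<Sum>j\<in>UNIV. x $ j * p $ j) - \<phi> p - z)"

definition Delta :: "(real^'n \<Rightarrow> real) \<Rightarrow> 'n \<Rightarrow> 'n::finite contact_point \<Rightarrow> real"
  where "Delta \<phi> a = (\<lambda>(x, p, z). x $ a - partial_diff a \<phi> p)"

text \<open>The embedding \<open>\<Phi>\<close> of the Legendre submanifold generated by \<open>-\<phi>\<close>, which is itself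
  identified with the domain of its coordinate \<open>p\<close>.\<close>

definition legendre_embedding :: "(real^'n \<Rightarrow> real) \<Rightarrow> real^'n \<Rightarrow> 'n::finite contact_point"
  where "legendre_embedding \<phi> p =
    (\<chi> i. partial_diff i \<phi> p, p, (\<Sum>i\<in>UNIV. p $ i * partial_diff i \<phi> p) - \<phi> p)"

definition Delta_zero_locus ::
    "(real^'n \<Rightarrow> real) \<Rightarrow> 'n::finite contact_point set \<Rightarrow> 'n contact_point set"
  where "Delta_zero_locus \<phi> C = {y \<in> C. Delta0 \<phi> y = 0 \<and> (\<forall>a. Delta \<phi> a y = 0)}"

lemma legendre_image_eq_Delta_zero_locus:
  assumes "proj_p ` C \<subseteq> P" and "legendre_embedding \<phi> ` P \<subseteq> C"
  shows "legendre_embedding \<phi> ` P = Delta_zero_locus \<phi> C"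
proof
  show "legendre_embedding \<phi> ` P \<subseteq> Delta_zero_locus \<phi> C"
    using assms(2)
    by (auto simp: Delta_zero_locus_def legendre_embedding_def Delta0_def Delta_def mult.commute)
next
  show "Delta_zero_locus \<phi> C \<subseteq> legendre_embedding \<phi> ` P"
  proof
    fix y assume y: "y \<in> Delta_zero_locus \<phi> C"
    obtain x p z where xpz: "y = (x, p, z)" by (cases y)
    have "p \<in> P"
      using y assms(1) by (force simp: xpz Delta_zero_locus_def proj_p_def)
    moreover have "y = legendre_embedding \<phi> p"
      using y by (auto simp: xpz Delta_zero_locus_def legendre_embedding_def Delta0_def Delta_def
          vec_eq_iff mult.commute)
    ultimately show "y \<in> legendre_embedding \<phi> ` P" by blast
  qed
qed

text \<open>The system that the components of the lifted vector field satisfy.\<close>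

definition lifted_equations ::
    "'n::finite contact_point set \<Rightarrow> (real^'n \<Rightarrow> real) \<Rightarrow> (real^'n \<Rightarrow> real^'n) \<Rightarrow>
     (real \<Rightarrow> real) \<Rightarrow> ('n contact_point \<Rightarrow> 'n contact_point) \<Rightarrow> bool"
  where "lifted_equations C \<phi> F \<Gamma> X \<longleftrightarrow> (\<forall>y\<in>C.
    (\<forall>a. lie_derivative X (Delta \<phi> a) y =
         - (\<Sum>b\<in>UNIV. partial_diff a (\<lambda>p. F p $ b) (proj_p y) * Delta \<phi> b y)
         - deriv \<Gamma> (Delta0 \<phi> y) * Delta \<phi> a y) \<and>
    (\<forall>a. lie_derivative X (\<lambda>y. proj_p y $ a) y = F (proj_p y) $ a) \<and>
    lie_derivative X (Delta0 \<phi>) y = - \<Gamma> (Delta0 \<phi> y))"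

definition lift_hamiltonian ::
    "(real^'n \<Rightarrow> real) \<Rightarrow> (real^'n \<Rightarrow> real^'n) \<Rightarrow> (real \<Rightarrow> real) \<Rightarrow>
     'n::finite contact_point \<Rightarrow> real"
  where "lift_hamiltonian \<phi> F \<Gamma> y =
    (\<Sum>a\<in>UNIV. Delta \<phi> a y * F (proj_p y) $ a) + \<Gamma> (Delta0 \<phi> y)"

end

theory Submission
  imports Defs
begin

text \<open>The functions \<open>\<Delta>\<^sup>a\<close>, \<open>p\<^sub>a\<close>, \<open>\<Delta>\<^sup>0\<close> are coordinates on \<open>C\<close>, because \<open>\<Delta>\<^sup>a\<close> differs from
  \<open>x\<^sup>a\<close> by a function of \<open>p\<close> and \<open>\<Delta>\<^sup>0\<close> differs from \<open>-z\<close> by a function of \<open>(x, p)\<close>.  Hence the lifted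
  equations determine \<open>X\<close>, and solving them for \<open>X\<close> shows existence and smoothness.  That this \<open>X\<close> is
  the contact Hamiltonian vector field of \<open>h\<close> amounts to comparing coefficients; the only input besides
  the chain rule is the symmetry of the Hessian of \<open>\<phi>\<close>.  Integral curves of \<open>X\<close> project to integral
  curves of \<open>F\<close>, and since smooth vector fields have unique integral curves, the flow of \<open>F\<close> is lifted.
  On the zero locus the terms of \<open>X\<close> that contain \<open>\<Delta>\<^sup>a\<close> or \<open>\<Gamma>(0)\<close> vanish; what remains is the
  push-forward of \<open>F\<close> under the Legendre embedding.\<close>


section \<open>Calculus of smooth maps\<close>

text \<open>Openness of \<open>S\<close> makes the derivative at a point of \<open>S\<close> depend
  only on the values on \<open>S\<close>. The claim thus passes to directional derivatives, so
  \<open>f\<close> and \<open>g\<close> vary in the induction.\<close>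

lemma ck_on_cong:
  assumes "open S" "\<And>x. x \<in> S \<Longrightarrow> f x = g x" "ck_on k S f"
  shows "ck_on k S g"
  using assms(2,3)
proof (induction k arbitrary: f g)
  case 0
  then show ?case by (auto cong: continuous_on_cong)
next
  case (Suc k)
  have d: "f differentiable (at x)" if "x \<in> S" for x
    using Suc.prems(2) that by simp
  have "frechet_derivative f (at x) = frechet_derivative g (at x)" if "x \<in> S" for x
    using frechet_derivative_transform_within_open[OF d[OF that] assms(1) that] Suc.prems(1) by blast
  moreover have "g differentiable (at x)" if "x \<in> S" for x
    using d[OF that] has_derivative_transform_within_open[OF _ assms(1) that] Suc.prems(1)
    unfolding differentiable_def by metis
  ultimately show ?case
    using Suc.IH[of "\<lambda>x. frechet_derivative f (at x) v" "\<lambda>x. frechet_derivative g (at x) v" for v]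
      Suc.prems(2) by simp
qed

text \<open>\<open>ck_on\<close> speaks of the chosen \<open>frechet_derivative\<close>; uniqueness
  of the derivative lets any explicit formula \<open>f'\<close> take its place.\<close>

lemma ck_on_SucI:
  assumes "open S" "\<And>x. x \<in> S \<Longrightarrow> (f has_derivative f' x) (at x)"
    "\<And>v. ck_on k S (\<lambda>x. f' x v)"
  shows "ck_on (Suc k) S f"
proof -
  have "ck_on k S (\<lambda>x. frechet_derivative f (at x) v)" for v
    by (rule ck_on_cong[OF assms(1) _ assms(3)[of v]])
      (use assms(2) frechet_derivative_at in metis)
  then show ?thesis using assms(2) by (auto simp: differentiable_def)
qed

lemma ck_on_SucD:
  assumes "ck_on (Suc k) S f"
  shows "x \<in> S \<Longrightarrow> (f has_derivative frechet_derivative f (at x)) (at x)"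
    and "ck_on k S (\<lambda>x. frechet_derivative f (at x) v)"
  using assms by (auto simp: frechet_derivative_works)

lemma ck_on_Suc_imp: "ck_on (Suc k) S f \<Longrightarrow> ck_on k S f"
proof (induction k arbitrary: f)
  case 0
  then show ?case
    by (auto simp: intro!: continuous_at_imp_continuous_on differentiable_imp_continuous_within)
next
  case (Suc k)
  then show ?case by simp
qed

lemma ck_on_const: "open S \<Longrightarrow> ck_on k S (\<lambda>x. c)"
proof (induction k arbitrary: c)
  case (Suc k)
  show ?case
    by (rule ck_on_SucI[OF Suc.prems, where f' = "\<lambda>x v. 0"]) (use Suc in auto)
qed auto

lemma ck_on_linear:
  assumes "open S" "bounded_linear f"
  shows "ck_on k S f"
proof (cases k)
  case 0
  then show ?thesis by (simp add: assms(2) linear_continuous_on)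
next
  case (Suc l)
  show ?thesis unfolding Suc
    by (rule ck_on_SucI[OF assms(1), where f' = "\<lambda>x. f"])
      (use assms in \<open>auto intro: ck_on_const bounded_linear_imp_has_derivative\<close>)
qed

lemma ck_on_linear_compose:
  assumes "open S" "bounded_linear L" "ck_on k S f"
  shows "ck_on k S (\<lambda>x. L (f x))"
  using assms(3)
proof (induction k arbitrary: f)
  case 0
  then show ?case using bounded_linear.continuous_on[OF assms(2)] by auto
next
  case (Suc k)
  show ?case
    by (rule ck_on_SucI[OF assms(1), where f' = "\<lambda>x v. L (frechet_derivative f (at x) v)"])
     (use Suc ck_on_SucD[OF Suc.prems] in \<open>auto intro: bounded_linear.has_derivative[OF assms(2)]\<close>)
qed

lemma ck_on_add:
  assumes "open S" "ck_on k S f" "ck_on k S g"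
  shows "ck_on k S (\<lambda>x. f x + g x)"
  using assms(2,3)
proof (induction k arbitrary: f g)
  case 0
  then show ?case by (auto intro: continuous_intros)
next
  case (Suc k)
  show ?case
    by (rule ck_on_SucI[OF assms(1), where
          f' = "\<lambda>x v. frechet_derivative f (at x) v + frechet_derivative g (at x) v"])
     (use Suc ck_on_SucD[OF Suc.prems(1)] ck_on_SucD[OF Suc.prems(2)] in
       \<open>auto intro: has_derivative_add\<close>)
qed

lemma ck_on_sum:
  assumes "open S" "\<And>i. i \<in> A \<Longrightarrow> ck_on k S (f i)"
  shows "ck_on k S (\<lambda>x. \<Sum>i\<in>A. f i x)"
  using assms(2)
  by (induction A rule: infinite_finite_induct) (auto intro: ck_on_const ck_on_add assms(1))

text \<open>The product rule writes the derivative as a sum of two values of \<open>B\<close> whose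
  arguments are again \<open>ck_on k\<close>, so the induction on \<open>k\<close> runs over all
  \<open>f\<close> and \<open>g\<close>.\<close>

lemma ck_on_bilinear:
  assumes "open S" "bounded_bilinear B" "ck_on k S f" "ck_on k S g"
  shows "ck_on k S (\<lambda>x. B (f x) (g x))"
  using assms(3,4)
proof (induction k arbitrary: f g)
  case 0
  then show ?case by (auto intro: bounded_bilinear.continuous_on[OF assms(2)])
next
  case (Suc k)
  show ?case
  proof (rule ck_on_SucI[OF assms(1)])
    show "((\<lambda>x. B (f x) (g x)) has_derivative
      (\<lambda>v. B (f x) (frechet_derivative g (at x) v) + B (frechet_derivative f (at x) v) (g x))) (at x)"
      if "x \<in> S" for x
      by (intro bounded_bilinear.FDERIV[OF assms(2)] ck_on_SucD(1)[OF Suc.prems(1) that]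
          ck_on_SucD(1)[OF Suc.prems(2) that])
    show "ck_on k S (\<lambda>x. B (f x) (frechet_derivative g (at x) v)
        + B (frechet_derivative f (at x) v) (g x))" for v
      using ck_on_Suc_imp[OF Suc.prems(1)] ck_on_Suc_imp[OF Suc.prems(2)]
        ck_on_SucD(2)[OF Suc.prems(1)] ck_on_SucD(2)[OF Suc.prems(2)]
      by (intro ck_on_add assms(1) Suc.IH)
  qed
qed

text \<open>Trades a varying direction for finitely many fixed ones: \<open>ck_on\<close> controls
  derivatives only in fixed directions, whereas the chain rule produces a direction that moves with
  the base point.\<close>

lemma linear_expand_Basis:
  fixes f :: "'a::euclidean_space \<Rightarrow> 'b::real_normed_vector"
  assumes "bounded_linear f"
  shows "f v = (\<Sum>b\<in>Basis. (v \<bullet> b) *\<^sub>R f b)"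
proof -
  interpret bounded_linear f by fact
  have "f v = f (\<Sum>b\<in>Basis. (v \<bullet> b) *\<^sub>R b)" by (simp add: euclidean_representation)
  then show ?thesis by (simp only: sum scaleR)
qed

text \<open>After expansion in a basis, each summand of the chain rule is a coordinate of
  \<open>?Dg x v\<close> times a composite of \<open>g\<close> with a derivative of \<open>f\<close>
  in a fixed direction. The latter is covered by the induction hypothesis, with \<open>f\<close>
  generalised.\<close>

lemma ck_on_compose:
  fixes g :: "'a::real_normed_vector \<Rightarrow> 'b::euclidean_space"
  assumes "open S" "open T" "ck_on k S g" "ck_on k T f" "g ` S \<subseteq> T"
  shows "ck_on k S (\<lambda>x. f (g x))"
  using assms(3,4)
proof (induction k arbitrary: f)
  case 0
  then show ?case using assms(5) by (auto intro: continuous_on_compose2)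
next
  case (Suc k)
  let ?Dg = "\<lambda>x. frechet_derivative g (at x)" and ?Df = "\<lambda>y. frechet_derivative f (at y)"
  have df: "(f has_derivative ?Df (g x)) (at (g x))" if "x \<in> S" for x
    using that assms(5) by (intro ck_on_SucD(1)[OF Suc.prems(2)]) auto
  show ?case
  proof (rule ck_on_SucI[OF assms(1)])
    fix x assume x: "x \<in> S"
    have "((\<lambda>x. f (g x)) has_derivative (\<lambda>v. ?Df (g x) (?Dg x v))) (at x)"
      by (rule has_derivative_compose[OF ck_on_SucD(1)[OF Suc.prems(1) x] df[OF x]])
    then show "((\<lambda>x. f (g x)) has_derivative
        (\<lambda>v. \<Sum>b\<in>Basis. (?Dg x v \<bullet> b) *\<^sub>R ?Df (g x) b)) (at x)"
      unfolding linear_expand_Basis[OF has_derivative_bounded_linear[OF df[OF x]], of "?Dg x v" for v] .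
  next
    show "ck_on k S (\<lambda>x. \<Sum>b\<in>Basis. (?Dg x v \<bullet> b) *\<^sub>R ?Df (g x) b)" for v
      by (intro ck_on_sum ck_on_bilinear[OF _ bounded_bilinear_scaleR]
          ck_on_linear_compose[OF _ bounded_linear_inner_left] assms(1)
          Suc.IH[OF ck_on_Suc_imp[OF Suc.prems(1)]]
          ck_on_SucD(2)[OF Suc.prems(1)] ck_on_SucD(2)[OF Suc.prems(2)])
  qed
qed

lemma ck_on_Pair:
  assumes "open S" "ck_on k S f" "ck_on k S g"
  shows "ck_on k S (\<lambda>x. (f x, g x))"
proof -
  have "bounded_linear (\<lambda>u. (u, 0))" "bounded_linear (Pair 0)"
    by (auto intro: bounded_linear_Pair bounded_linear_ident bounded_linear_zero)
  then have "ck_on k S (\<lambda>x. (f x, 0) + (0, g x))"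
    by (intro ck_on_add ck_on_linear_compose[where L = "\<lambda>u. (u, 0)"]
        ck_on_linear_compose[where L = "Pair 0"] assms)
  then show ?thesis by simp
qed

section \<open>Closure properties of smooth maps\<close>

lemma smooth_on_has_derivative:
  assumes "smooth_on S f" "x \<in> S"
  shows "(f has_derivative frechet_derivative f (at x)) (at x)"
  using ck_on_SucD(1)[of 0] assms unfolding smooth_on_def by blast

lemma smooth_on_frechet_derivative:
  assumes "smooth_on S f"
  shows "smooth_on S (\<lambda>x. frechet_derivative f (at x) v)"
  using assms ck_on_SucD(2) unfolding smooth_on_def by blast

lemma smooth_on_continuous_on: "smooth_on S f \<Longrightarrow> continuous_on S f"
  unfolding smooth_on_def by (metis ck_on.simps(1))

lemma smooth_on_cong:
  "open S \<Longrightarrow> smooth_on S f \<Longrightarrow> (\<And>x. x \<in> S \<Longrightarrow> f x = g x) \<Longrightarrow> smooth_on S g"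
  unfolding smooth_on_def using ck_on_cong by blast

lemma smooth_on_const: "open S \<Longrightarrow> smooth_on S (\<lambda>x. c)"
  by (simp add: smooth_on_def ck_on_const)

lemma smooth_on_linear: "open S \<Longrightarrow> bounded_linear f \<Longrightarrow> smooth_on S f"
  by (simp add: smooth_on_def ck_on_linear)

lemma smooth_on_linear_compose:
  "open S \<Longrightarrow> bounded_linear L \<Longrightarrow> smooth_on S f \<Longrightarrow> smooth_on S (\<lambda>x. L (f x))"
  by (simp add: smooth_on_def ck_on_linear_compose)

lemma smooth_on_add:
  "open S \<Longrightarrow> smooth_on S f \<Longrightarrow> smooth_on S g \<Longrightarrow> smooth_on S (\<lambda>x. f x + g x)"
  by (simp add: smooth_on_def ck_on_add)

lemma smooth_on_minus: "open S \<Longrightarrow> smooth_on S f \<Longrightarrow> smooth_on S (\<lambda>x. - f x)"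
  by (rule smooth_on_linear_compose[OF _ bounded_linear_minus[OF bounded_linear_ident]])

lemma smooth_on_diff:
  "open S \<Longrightarrow> smooth_on S f \<Longrightarrow> smooth_on S g \<Longrightarrow> smooth_on S (\<lambda>x. f x - g x)"
  using smooth_on_add[OF _ _ smooth_on_minus, of S f g] by simp

lemma smooth_on_sum:
  "open S \<Longrightarrow> (\<And>i. i \<in> A \<Longrightarrow> smooth_on S (f i)) \<Longrightarrow> smooth_on S (\<lambda>x. \<Sum>i\<in>A. f i x)"
  by (simp add: smooth_on_def ck_on_sum)

lemma smooth_on_scaleR:
  "open S \<Longrightarrow> smooth_on S f \<Longrightarrow> smooth_on S g \<Longrightarrow> smooth_on S (\<lambda>x. f x *\<^sub>R g x)"
  by (simp add: smooth_on_def ck_on_bilinear[OF _ bounded_bilinear_scaleR])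

lemma smooth_on_mult:
  fixes f g :: "'a::real_normed_vector \<Rightarrow> real"
  shows "open S \<Longrightarrow> smooth_on S f \<Longrightarrow> smooth_on S g \<Longrightarrow> smooth_on S (\<lambda>x. f x * g x)"
  using smooth_on_scaleR[of S f g] by simp

lemma smooth_on_compose:
  fixes g :: "'a::real_normed_vector \<Rightarrow> 'b::euclidean_space"
  assumes "open S" "open T" "smooth_on S g" "smooth_on T f" "g ` S \<subseteq> T"
  shows "smooth_on S (\<lambda>x. f (g x))"
  using assms by (simp add: smooth_on_def ck_on_compose)

lemma smooth_on_Pair:
  "open S \<Longrightarrow> smooth_on S f \<Longrightarrow> smooth_on S g \<Longrightarrow> smooth_on S (\<lambda>x. (f x, g x))"
  by (simp add: smooth_on_def ck_on_Pair)

lemma vec_lambda_eq_sum_axis: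
  fixes f :: "'n::finite \<Rightarrow> real"
  shows "(\<chi> i. f i) = (\<Sum>i\<in>UNIV. f i *\<^sub>R axis i 1)"
  by (auto simp: vec_eq_iff axis_def if_distrib cong: if_cong)

lemma smooth_on_vec_lambda:
  fixes f :: "'n::finite \<Rightarrow> 'a::real_normed_vector \<Rightarrow> real"
  assumes "open S" "\<And>i. smooth_on S (f i)"
  shows "smooth_on S (\<lambda>x. \<chi> i. f i x)"
  unfolding vec_lambda_eq_sum_axis
  by (intro smooth_on_sum smooth_on_scaleR smooth_on_const assms)


section \<open>Symmetry of second derivatives\<close>

lemma continuous_at_eventually_dist:
  fixes f :: "'a::t2_space \<Rightarrow> 'b::metric_space"
  assumes "continuous (at x) f" "e > 0"
  shows "\<forall>\<^sub>F y in nhds x. dist (f y) (f x) < e"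
  using assms unfolding continuous_within tendsto_at_iff_tendsto_nhds by (rule tendstoD)

text \<open>The mean value theorem in direction \<open>v\<close>, then in direction \<open>w\<close>.  The left-hand side is symmetric
  in \<open>v\<close> and \<open>w\<close>, which forces the two mixed second derivatives to agree in the limit.\<close>

lemma second_difference_eq:
  fixes f :: "'a::real_normed_vector \<Rightarrow> real"
  assumes f: "smooth_on S f" and s: "s > 0"
    and seg: "\<And>a b. a \<in> {0..s} \<Longrightarrow> b \<in> {0..s} \<Longrightarrow> x + a *\<^sub>R v + b *\<^sub>R w \<in> S"
  shows "\<exists>a\<in>{0..s}. \<exists>b\<in>{0..s}. f (x + s *\<^sub>R v + s *\<^sub>R w) - f (x + s *\<^sub>R v) - f (x + s *\<^sub>R w) + f x
    = s * s * frechet_derivative (\<lambda>y. frechet_derivative f (at y) v) (at (x + a *\<^sub>R v + b *\<^sub>R w)) w"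
proof -
  let ?D = "\<lambda>y. frechet_derivative f (at y)"
  let ?q = "\<lambda>a b. x + a *\<^sub>R v + b *\<^sub>R w"
  have 1: "((\<lambda>a. f (?q a b)) has_real_derivative ?D (?q a b) v) (at a)"
    if "a \<in> {0..s}" "b \<in> {0..s}" for a b
  proof -
    note d = smooth_on_has_derivative[OF f seg[OF that]]
    have "((\<lambda>a. ?q a b) has_derivative (\<lambda>h. h *\<^sub>R v)) (at a)"
      by (auto intro!: derivative_eq_intros)
    from has_derivative_compose[OF this d]
    show ?thesis
      by (simp add: has_field_derivative_def mult_commute_abs
          linear_simps(5)[OF has_derivative_bounded_linear[OF d]])
  qed
  \<comment> \<open>The mean value theorem is applied to the increment in direction \<open>w\<close>
    as a function of the displacement along \<open>v\<close>, so that one intermediate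
    \<open>a\<close> serves both ends of the increment.\<close>
  have "\<exists>a>0. a < s \<and> (f (?q s s) - f (?q s 0)) - (f (?q 0 s) - f (?q 0 0))
      = (s - 0) * (?D (?q a s) v - ?D (?q a 0) v)"
    by (rule MVT2[OF s]) (use s in \<open>auto intro!: DERIV_diff 1 simp del: scale_zero_left\<close>)
  then obtain a where a: "0 < a" "a < s" and eq1: "(f (?q s s) - f (?q s 0)) - (f (?q 0 s) - f (?q 0 0))
      = s * (?D (?q a s) v - ?D (?q a 0) v)" by auto
  let ?E = "\<lambda>y. frechet_derivative (\<lambda>y. ?D y v) (at y) w"
  have 2: "((\<lambda>b. ?D (?q a b) v) has_real_derivative ?E (?q a b)) (at b)" if "b \<in> {0..s}" for b
  proof -
    have "?q a b \<in> S" using a that by (auto intro: seg)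
    note d = smooth_on_has_derivative[OF smooth_on_frechet_derivative[OF f, of v] this]
    have "((\<lambda>b. ?q a b) has_derivative (\<lambda>h. h *\<^sub>R w)) (at b)"
      by (auto intro!: derivative_eq_intros)
    from has_derivative_compose[OF this d]
    show ?thesis
      by (simp add: has_field_derivative_def mult_commute_abs
          linear_simps(5)[OF has_derivative_bounded_linear[OF d]])
  qed
  have "\<exists>b>0. b < s \<and> ?D (?q a s) v - ?D (?q a 0) v = (s - 0) * ?E (?q a b)"
    by (rule MVT2[OF s]) (use 2 in auto)
  then obtain b where "0 < b" "b < s" "?D (?q a s) v - ?D (?q a 0) v = s * ?E (?q a b)" by auto
  with a eq1 show ?thesis by (intro bexI[of _ a] bexI[of _ b]) (auto simp: algebra_simps)
qed

text \<open>If the mixed derivatives differed at \<open>x\<close>, continuity would keep each of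
  them within half of the gap of its value at \<open>x\<close> on a whole neighbourhood, yet
  \<open>second_difference_eq\<close> gives two nearby points where they are equal.\<close>

lemma second_derivative_symmetric:
  fixes f :: "'a::real_normed_vector \<Rightarrow> real"
  assumes "open S" "smooth_on S f" "x \<in> S"
  shows "frechet_derivative (\<lambda>y. frechet_derivative f (at y) v) (at x) w =
    frechet_derivative (\<lambda>y. frechet_derivative f (at y) w) (at x) v" (is "?A v w x = ?A w v x")
proof (rule ccontr)
  assume "?A v w x \<noteq> ?A w v x"
  then have e: "\<bar>?A v w x - ?A w v x\<bar> / 2 > 0" (is "?e > 0") by simp
  have "continuous (at x) (?A u u')" for u u'
    using smooth_on_continuous_on[OF smooth_on_frechet_derivative[OF smooth_on_frechet_derivative[OF assms(2)]]]
      assms(1,3) continuous_on_eq_continuous_at by blast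
  then have near: "\<forall>\<^sub>F y in nhds x. dist (?A u u' y) (?A u u' x) < ?e" for u u'
    using e by (rule continuous_at_eventually_dist)
  have "\<forall>\<^sub>F y in nhds x. y \<in> S \<and> dist (?A v w y) (?A v w x) < ?e \<and> dist (?A w v y) (?A w v x) < ?e"
    using eventually_nhds_in_open[OF assms(1,3)] near[of v w] near[of w v] by eventually_elim auto
  then obtain d where d: "d > 0"
    and D: "\<And>y. dist y x < d \<Longrightarrow> y \<in> S \<and> dist (?A v w y) (?A v w x) < ?e \<and> dist (?A w v y) (?A w v x) < ?e"
    unfolding eventually_nhds_metric by blast
  \<comment> \<open>The parallelogram spanned by \<open>s *\<^sub>R v\<close> and
    \<open>s *\<^sub>R w\<close> reaches at most \<open>s * N = d / 2\<close> away from
    \<open>x\<close>; the summand 1 keeps the divisor positive.\<close>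
  define N where "N = norm v + norm w + 1"
  define s where "s = d / 2 / N"
  have N: "N > 0" by (simp add: N_def add_nonneg_pos)
  then have s: "s > 0" using d by (simp add: s_def)
  have bd: "dist (x + a *\<^sub>R v + b *\<^sub>R w) x < d" if "a \<in> {0..s}" "b \<in> {0..s}" for a b
  proof -
    have "dist (x + a *\<^sub>R v + b *\<^sub>R w) x \<le> norm (a *\<^sub>R v) + norm (b *\<^sub>R w)"
      using norm_triangle_ineq[of "a *\<^sub>R v" "b *\<^sub>R w"] by (simp add: dist_norm add.assoc)
    also have "\<dots> \<le> s * norm v + s * norm w"
      using that by (auto intro!: add_mono mult_right_mono)
    also have "\<dots> \<le> s * (norm v + norm w + 1)" using s by (simp add: algebra_simps)
    also have "\<dots> = d / 2" using N by (simp add: s_def N_def[symmetric])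
    finally show ?thesis using d by simp
  qed
  have bd': "dist (x + a *\<^sub>R w + b *\<^sub>R v) x < d" if "a \<in> {0..s}" "b \<in> {0..s}" for a b
    using bd[OF that(2,1)] by (simp add: algebra_simps)
  obtain a b where ab: "a \<in> {0..s}" "b \<in> {0..s}"
    and eq: "f (x + s *\<^sub>R v + s *\<^sub>R w) - f (x + s *\<^sub>R v) - f (x + s *\<^sub>R w) + f x
      = s * s * ?A v w (x + a *\<^sub>R v + b *\<^sub>R w)"
    using second_difference_eq[OF assms(2) s, of x v w] D bd by blast
  obtain a' b' where ab': "a' \<in> {0..s}" "b' \<in> {0..s}"
    and eq': "f (x + s *\<^sub>R w + s *\<^sub>R v) - f (x + s *\<^sub>R w) - f (x + s *\<^sub>R v) + f x
      = s * s * ?A w v (x + a' *\<^sub>R w + b' *\<^sub>R v)"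
    using second_difference_eq[OF assms(2) s, of x w v] D bd' by blast
  have "f (x + s *\<^sub>R v + s *\<^sub>R w) - f (x + s *\<^sub>R v) - f (x + s *\<^sub>R w) + f x =
      f (x + s *\<^sub>R w + s *\<^sub>R v) - f (x + s *\<^sub>R w) - f (x + s *\<^sub>R v) + f x"
    by (simp add: algebra_simps)
  then have "?A v w (x + a *\<^sub>R v + b *\<^sub>R w) = ?A w v (x + a' *\<^sub>R w + b' *\<^sub>R v)"
    using eq eq' s by simp
  then show False
    using D[OF bd[OF ab]] D[OF bd'[OF ab']] unfolding dist_real_def by (auto simp: abs_if split: if_splits)
qed


section \<open>Uniqueness of integral curves\<close>

text \<open>On a compact ball the derivative in each basis direction is bounded by continuity. The
  sum of these bounds dominates the operator norm, and the mean value inequality on the convex ball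
  gives the Lipschitz estimate.\<close>

lemma smooth_on_locally_lipschitz:
  fixes X :: "'a::euclidean_space \<Rightarrow> 'b::real_normed_vector"
  assumes "open S" "smooth_on S X" "x \<in> S"
  obtains r L where "r > 0" "L \<ge> 0"
    "\<And>u v. u \<in> cball x r \<Longrightarrow> v \<in> cball x r \<Longrightarrow> norm (X u - X v) \<le> L * norm (u - v)"
proof -
  obtain r where r: "r > 0" "cball x r \<subseteq> S"
    using assms(1,3) open_contains_cball by blast
  let ?D = "\<lambda>y. frechet_derivative X (at y)"
  have "\<exists>B. \<forall>y\<in>cball x r. norm (?D y b) \<le> B" for b
  proof -
    have "continuous_on (cball x r) (\<lambda>y. ?D y b)"
      using smooth_on_continuous_on[OF smooth_on_frechet_derivative[OF assms(2)]] r(2)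
        continuous_on_subset by blast
    then have "bounded ((\<lambda>y. ?D y b) ` cball x r)"
      by (intro compact_imp_bounded compact_continuous_image) auto
    then show ?thesis by (auto simp: bounded_iff)
  qed
  then obtain B where B: "\<And>b y. y \<in> cball x r \<Longrightarrow> norm (?D y b) \<le> B b" by metis
  define L where "L = (\<Sum>b\<in>Basis. B b)"
  have B0: "B b \<ge> 0" for b
    using order_trans[OF norm_ge_zero B[of x b]] r(1) by simp
  have on: "onorm (?D y) \<le> L" if y: "y \<in> cball x r" for y
  proof (rule onorm_le)
    fix v :: 'a
    have "bounded_linear (?D y)"
      using smooth_on_has_derivative[OF assms(2)] y r(2) has_derivative_bounded_linear by blast
    then have "norm (?D y v) = norm (\<Sum>b\<in>Basis. (v \<bullet> b) *\<^sub>R ?D y b)"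
      by (rule arg_cong[OF linear_expand_Basis])
    also have "\<dots> \<le> (\<Sum>b\<in>Basis. norm v * B b)"
      by (intro sum_norm_le) (auto intro!: mult_mono Basis_le_norm B[OF y])
    finally show "norm (?D y v) \<le> L * norm v"
      by (simp add: L_def sum_distrib_left mult.commute)
  qed
  show thesis
  proof (rule that[OF r(1), of L])
    show "L \<ge> 0" by (simp add: L_def sum_nonneg B0)
    show "norm (X u - X v) \<le> L * norm (u - v)" if "u \<in> cball x r" "v \<in> cball x r" for u v
      by (rule differentiable_bound[OF convex_cball _ on that])
        (use r(2) smooth_on_has_derivative[OF assms(2)] has_derivative_at_withinI in blast)
  qed
qed

text \<open>The set where two integral curves agree is closed, and it is open because on an interval around
  \<open>t0\<close> of radius at most \<open>1 / (2 * (L + 1))\<close> the maximum of the distance is bounded by half of itself.\<close>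

lemma integral_curve_unique:
  fixes X :: "'a::euclidean_space \<Rightarrow> 'a"
  assumes S: "open S" "smooth_on S X"
    and c: "integral_curve X S I c" and d: "integral_curve X S I' d"
    and 0: "c 0 = d 0" and t: "t \<in> I" "t \<in> I'"
  shows "c t = d t"
proof -
  define K where "K = I \<inter> I'"
  define E where "E = {t\<in>K. c t = d t}"
  have K: "open K" "connected K" "0 \<in> K" "t \<in> K"
    using c d t unfolding K_def integral_curve_def
    by (auto simp: is_interval_connected_1[symmetric] is_interval_Int)
  have vd: "(c has_vector_derivative X (c s)) (at s)" "(d has_vector_derivative X (d s)) (at s)"
      "c s \<in> S" if "s \<in> K" for s
    using c d that unfolding K_def integral_curve_def by auto
  have cont: "continuous (at s) c" "continuous (at s) d" if "s \<in> K" for s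
    using vd[OF that] has_vector_derivative_continuous by blast+
  have openE: "open E"
    unfolding open_contains_ball
  proof
    fix t0 assume "t0 \<in> E"
    then have t0: "t0 \<in> K" "d t0 = c t0" by (auto simp: E_def)
    obtain r L where r: "r > 0" and L: "L \<ge> 0"
      and lip: "\<And>u v. u \<in> cball (c t0) r \<Longrightarrow> v \<in> cball (c t0) r \<Longrightarrow> norm (X u - X v) \<le> L * norm (u - v)"
      using smooth_on_locally_lipschitz[OF S vd(3)[OF t0(1)]] by blast
    have near: "\<forall>\<^sub>F s in nhds t0. s \<in> K \<and> dist (c s) (c t0) < r \<and> dist (d s) (d t0) < r"
      by (intro eventually_conj eventually_nhds_in_open[OF K(1) t0(1)]
          continuous_at_eventually_dist cont[OF t0(1)] r)
    then obtain e where e: "e > 0" and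
      E: "\<And>s. dist s t0 < e \<Longrightarrow> s \<in> K \<and> dist (c s) (c t0) < r \<and> dist (d s) (d t0) < r"
      unfolding eventually_nhds_metric by blast
    \<comment> \<open>\<open>e / 2\<close> keeps the closed interval inside the neighbourhood where
      the Lipschitz bound applies; the other term yields \<open>L * \<delta> \<le> 1 / 2\<close>,
      with \<open>L + 1\<close> avoiding division by zero.\<close>
    define \<delta> where "\<delta> = min (e / 2) (1 / (2 * (L + 1)))"
    have \<delta>: "\<delta> > 0" "\<delta> < e" "L * \<delta> \<le> 1 / 2"
    proof -
      show "\<delta> > 0" "\<delta> < e" using e L by (auto simp: \<delta>_def min_less_iff_disj)
      have "L * \<delta> \<le> L * (1 / (2 * (L + 1)))"
        using L by (intro mult_left_mono) (auto simp: \<delta>_def)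
      also have "\<dots> \<le> 1 / 2" using L by (simp add: field_simps)
      finally show "L * \<delta> \<le> 1 / 2" .
    qed
    define T where "T = cball t0 \<delta>"
    define w where "w = (\<lambda>s. c s - d s)"
    have TK: "s \<in> K" "c s \<in> cball (c t0) r" "d s \<in> cball (c t0) r" if "s \<in> T" for s
      using E[of s] that \<delta> t0(2) by (auto simp: T_def dist_commute less_imp_le)
    have "continuous_on T w"
      unfolding w_def using cont TK(1)
      by (intro continuous_at_imp_continuous_on ballI continuous_diff) auto
    moreover have "compact T" "T \<noteq> {}" "convex T" "t0 \<in> T" using \<delta>(1) by (auto simp: T_def)
    ultimately obtain m where m: "m \<in> T" and max: "\<And>s. s \<in> T \<Longrightarrow> norm (w s) \<le> norm (w m)"
      using continuous_attains_sup[of T "\<lambda>s. norm (w s)"] continuous_on_norm by blast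
    \<comment> \<open>\<open>w\<close> vanishes at \<open>t0\<close>, and its derivative
      \<open>X (c s) - X (d s)\<close> is at most \<open>L\<close> times the maximum
      \<open>norm (w m)\<close> on \<open>T\<close>, by the Lipschitz bound.\<close>
    have "norm (w m - w t0) \<le> L * norm (w m) * norm (m - t0)"
    proof (rule differentiable_bound[OF \<open>convex T\<close> _ _ m \<open>t0 \<in> T\<close>])
      fix s assume s: "s \<in> T"
      have "(w has_vector_derivative X (c s) - X (d s)) (at s within T)"
        unfolding w_def
        by (rule has_vector_derivative_at_within) (intro has_vector_derivative_diff vd TK(1)[OF s])
      then show "(w has_derivative (\<lambda>h. h *\<^sub>R (X (c s) - X (d s)))) (at s within T)"
        by (simp add: has_vector_derivative_def)
      have "norm (X (c s) - X (d s)) \<le> L * norm (w s)"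
        using lip TK[OF s] unfolding w_def by blast
      also have "\<dots> \<le> L * norm (w m)" using L max[OF s] by (intro mult_left_mono)
      finally show "onorm (\<lambda>h. h *\<^sub>R (X (c s) - X (d s))) \<le> L * norm (w m)"
        by (simp add: onorm_scaleR_left onorm_id)
    qed
    also have "\<dots> \<le> L * norm (w m) * \<delta>"
      using m L by (intro mult_left_mono) (auto simp: T_def dist_norm norm_minus_commute)
    also have "\<dots> \<le> 1 / 2 * norm (w m)"
      using mult_right_mono[OF \<delta>(3), of "norm (w m)"] by (simp add: algebra_simps)
    finally have "norm (w m) \<le> 0" using t0 by (simp add: w_def)
    then have "w s = 0" if "s \<in> T" for s using max[OF that] by simp
    then have "ball t0 \<delta> \<subseteq> E"
      using TK(1) by (auto simp: E_def w_def T_def)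
    then show "\<exists>e>0. ball t0 e \<subseteq> E" using \<delta>(1) by blast
  qed
  \<comment> \<open>\<open>K - E\<close> is the set where the continuous difference is nonzero,
    hence open; since \<open>K\<close> is connected and \<open>E\<close> contains 0, it is
    empty.\<close>
  have "continuous_on K (\<lambda>s. c s - d s)"
    using cont by (intro continuous_at_imp_continuous_on ballI continuous_diff) auto
  then have "open (K \<inter> (\<lambda>s. c s - d s) -` (-{0}))"
    using K(1) by (intro continuous_open_preimage) auto
  also have "K \<inter> (\<lambda>s. c s - d s) -` (-{0}) = K - E" by (auto simp: E_def)
  finally have "E \<inter> K = {} \<or> (K - E) \<inter> K = {}"
    using connectedD[OF K(2) openE, of "K - E"] by (auto simp: E_def)
  moreover have "0 \<in> E" using K(3) 0 by (simp add: E_def)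
  ultimately show ?thesis using K(3,4) by (auto simp: E_def)
qed

section \<open>Flows and their lifts\<close>

lemma flow_eqI:
  fixes X :: "'a::euclidean_space \<Rightarrow> 'a"
  assumes "open S" "smooth_on S X" "integral_curve X S I c" "t \<in> I"
  shows "flow X S t (c 0) = c t"
  unfolding flow_def
  using assms integral_curve_unique[OF assms(1,2) _ assms(3)] by (intro the_equality) metis+

text \<open>By \<open>rel\<close> the two fields are related by the linear map \<open>proj\<close>,
  so the chain rule turns an integral curve of \<open>Y\<close> into one of \<open>X\<close> on the
  same interval. This gives the inclusion of the flow domains as well, and uniqueness identifies the
  flows with these curves.\<close>

lemma flow_liftI:
  fixes proj :: "'b::euclidean_space \<Rightarrow> 'a::euclidean_space"
  assumes "open N" "smooth_on N Y" "open M" "smooth_on M X"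
    and "proj ` N = M" "DIM('a) < DIM('b)" "bounded_linear proj"
    and rel: "\<And>y. y \<in> N \<Longrightarrow> proj (Y y) = X (proj y)"
  shows "flow_lift proj N Y M X"
proof -
  have "t \<in> flow_domain X M (proj y) \<and> flow X M t (proj y) = proj (flow Y N t y)"
    if t: "t \<in> flow_domain Y N y" for y t
  proof -
    obtain I c where c: "integral_curve Y N I c" "c 0 = y" "t \<in> I"
      using t by (auto simp: flow_domain_def)
    have pc: "integral_curve X M I (\<lambda>t. proj (c t))"
      unfolding integral_curve_def
    proof (intro conjI ballI)
      fix s assume "s \<in> I"
      then have s: "c s \<in> N" "(c has_vector_derivative Y (c s)) (at s)"
        using c(1) by (auto simp: integral_curve_def)
      then show "proj (c s) \<in> M" using assms(5) by blast
      show "((\<lambda>t. proj (c t)) has_vector_derivative X (proj (c s))) (at s)"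
        using bounded_linear.has_vector_derivative[OF assms(7) s(2)] rel[OF s(1)] by simp
    qed (use c(1) in \<open>auto simp: integral_curve_def\<close>)
    then have "t \<in> flow_domain X M (proj y)"
      using c(2,3) by (auto simp: flow_domain_def)
    then show ?thesis
      using flow_eqI[OF assms(1,2) c(1,3)] flow_eqI[OF assms(3,4) pc c(3)] c(2) by simp
  qed
  then show ?thesis using assms(5,6) by (simp add: flow_lift_def)
qed


section \<open>The lifted vector field\<close>

lemma has_derivative_vec_lambda:
  fixes f :: "'n::finite \<Rightarrow> 'a::real_normed_vector \<Rightarrow> real"
  assumes "\<And>i. (f i has_derivative f' i) net"
  shows "((\<lambda>x. \<chi> i. f i x) has_derivative (\<lambda>v. \<chi> i. f' i v)) net"
proof -
  have "((\<lambda>x. \<Sum>i\<in>UNIV. f i x *\<^sub>R (axis i 1 :: real^'n)) has_derivative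
      (\<lambda>v. \<Sum>i\<in>UNIV. f' i v *\<^sub>R axis i 1)) net"
    by (intro has_derivative_sum has_derivative_scaleR_left assms)
  then show ?thesis by (simp only: vec_lambda_eq_sum_axis)
qed

lemma frechet_derivative_eq_sum_partial_diff:
  fixes f :: "real^'n \<Rightarrow> real"
  assumes "f differentiable (at p)"
  shows "frechet_derivative f (at p) v = (\<Sum>a\<in>UNIV. v $ a * partial_diff a f p)"
proof -
  have lin: "linear (frechet_derivative f (at p))" using assms by (rule linear_frechet_derivative)
  have "v = (\<Sum>a\<in>UNIV. v $ a *\<^sub>R axis a 1)"
    using vec_lambda_eq_sum_axis[of "\<lambda>a. v $ a"] by simp
  then have "frechet_derivative f (at p) v
      = frechet_derivative f (at p) (\<Sum>a\<in>UNIV. v $ a *\<^sub>R axis a 1)" by simp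
  then show ?thesis
    by (simp add: linear_sum[OF lin] linear_scale[OF lin] partial_diff_def)
qed

lemma smooth_on_has_derivative_partial_diff:
  fixes f :: "real^'n \<Rightarrow> real"
  assumes "smooth_on S f" "p \<in> S"
  shows "(f has_derivative (\<lambda>v. \<Sum>a\<in>UNIV. v $ a * partial_diff a f p)) (at p)"
proof -
  note d = smooth_on_has_derivative[OF assms]
  show ?thesis
    unfolding frechet_derivative_eq_sum_partial_diff[OF differentiableI[OF d], symmetric] by (rule d)
qed

lemma smooth_on_partial_diff: "smooth_on S f \<Longrightarrow> smooth_on S (partial_diff a f)"
  using smooth_on_frechet_derivative[of S f "axis a 1"] by (simp add: partial_diff_def[abs_def])

lemma proj_p_eq: "proj_p = (\<lambda>y. fst (snd y))"
  by (auto simp: proj_p_def)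

lemma Delta_eq: "Delta \<phi> a = (\<lambda>y. fst y $ a - partial_diff a \<phi> (proj_p y))"
  by (auto simp: Delta_def proj_p_eq)

lemma Delta0_eq:
  "Delta0 \<phi> = (\<lambda>y. (\<Sum>j\<in>UNIV. fst y $ j * proj_p y $ j) - \<phi> (proj_p y) - snd (snd y))"
  by (auto simp: Delta0_def proj_p_eq)

lemma contact_form_eq:
  "contact_form y w = snd (snd w) - (\<Sum>a\<in>UNIV. proj_p y $ a * fst w $ a)"
  by (cases y; cases w) (simp add: contact_form_def proj_p_eq)

lemma bounded_linear_proj_p: "bounded_linear (proj_p :: 'n::finite contact_point \<Rightarrow> real^'n)"
  unfolding proj_p_eq by (intro bounded_linear_fst_comp bounded_linear_snd)

text \<open>This is \<open>d\<lambda> = dx^a \<and> dp_a\<close>: the coefficients of the contact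
  form depend on the base point only through \<open>p\<close>, and linearly.\<close>

lemma exterior_derivative_contact_form:
  "exterior_derivative contact_form y v w =
    (\<Sum>a\<in>UNIV. proj_p w $ a * fst v $ a) - (\<Sum>a\<in>UNIV. proj_p v $ a * fst w $ a)"
proof -
  have "((\<lambda>q. contact_form q w) has_derivative (\<lambda>v. - (\<Sum>a\<in>UNIV. proj_p v $ a * fst w $ a))) (at y)" for w
    unfolding contact_form_eq
    by (auto intro!: derivative_eq_intros bounded_linear.has_derivative[OF bounded_linear_vec_nth]
        bounded_linear_imp_has_derivative[OF bounded_linear_proj_p])
  from frechet_derivative_at[OF this, symmetric] show ?thesis
    by (simp add: exterior_derivative_def)
qed

text \<open>The lifted equations solved for the vector field. The first summand of \<open>u\<close>
  is the derivative of the gradient of \<phi>, moved over from \<open>d\<Delta>^a/dt\<close>. The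
  last component is written with \<open>h\<close> so that \<open>\<lambda>(X) = h\<close> can be
  read off.\<close>

definition lifted_vf ::
    "(real^'n \<Rightarrow> real) \<Rightarrow> (real^'n \<Rightarrow> real^'n) \<Rightarrow> (real \<Rightarrow> real) \<Rightarrow>
     'n::finite contact_point \<Rightarrow> 'n contact_point"
  where "lifted_vf \<phi> F \<Gamma> y =
    (let p = proj_p y;
         u = (\<chi> a. frechet_derivative (partial_diff a \<phi>) (at p) (F p)
            - (\<Sum>b\<in>UNIV. partial_diff a (\<lambda>p. F p $ b) p * Delta \<phi> b y)
            - deriv \<Gamma> (Delta0 \<phi> y) * Delta \<phi> a y)
     in (u, F p, (\<Sum>a\<in>UNIV. p $ a * u $ a) + lift_hamiltonian \<phi> F \<Gamma> y))"

text \<open>Canonical coordinates are local, so everything lives on open sets: \<open>C\<close> is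
  the chart, \<open>P\<close> the Legendre submanifold in its coordinate \<open>p\<close>, and
  \<open>J\<close> a domain for \<Gamma> that contains the values of
  \<open>Delta0 \<phi>\<close>.\<close>

locale legendre_lift =
  fixes C :: "'n::finite contact_point set"
    and P :: "(real^'n) set" and J :: "real set"
    and \<phi> :: "real^'n \<Rightarrow> real" and F :: "real^'n \<Rightarrow> real^'n" and \<Gamma> :: "real \<Rightarrow> real"
  assumes open_C: "open C" and open_P: "open P" and open_J: "open J"
    and proj_C: "proj_p ` C \<subseteq> P" and embed_P: "legendre_embedding \<phi> ` P \<subseteq> C"
    and Delta0_C: "Delta0 \<phi> ` C \<subseteq> J"
    and smooth_phi: "smooth_on P \<phi>" and smooth_F: "smooth_on P F" and smooth_Gamma: "smooth_on J \<Gamma>"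
begin

abbreviation hess :: "'n \<Rightarrow> real^'n \<Rightarrow> real^'n \<Rightarrow> real"
  where "hess a p \<equiv> frechet_derivative (partial_diff a \<phi>) (at p)"

lemma proj_in_P: "y \<in> C \<Longrightarrow> proj_p y \<in> P"
  using proj_C by blast

text \<open>The embedding is a section of the projection.\<close>

lemma proj_image: "proj_p ` C = P"
proof
  show "P \<subseteq> proj_p ` C"
    using embed_P by (force simp: legendre_embedding_def proj_p_def)
qed (rule proj_C)

lemma has_derivative_partial_phi:
  "p \<in> P \<Longrightarrow> (partial_diff a \<phi> has_derivative hess a p) (at p)"
  by (rule smooth_on_has_derivative[OF smooth_on_partial_diff[OF smooth_phi]])

text \<open>Both sides are the Hessian of \<phi> as a bilinear form applied to \<open>w\<close> and
  \<open>v\<close>; in coordinates they differ only in the order of the two partial derivatives and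
  of the two sums.\<close>

lemma hess_symmetric:
  assumes "p \<in> P"
  shows "(\<Sum>a\<in>UNIV. w $ a * hess a p v) = (\<Sum>a\<in>UNIV. hess a p w * v $ a)"
proof -
  have "hess a p v = (\<Sum>b\<in>UNIV. v $ b * partial_diff b (partial_diff a \<phi>) p)" for a v
    by (rule frechet_derivative_eq_sum_partial_diff)
      (use has_derivative_partial_phi[OF assms] in \<open>auto simp: differentiable_def\<close>)
  moreover have "partial_diff b (partial_diff a \<phi>) p = partial_diff a (partial_diff b \<phi>) p" for a b
    using second_derivative_symmetric[OF open_P smooth_phi assms, of "axis a 1" "axis b 1"]
    by (simp add: partial_diff_def[abs_def])
  ultimately have "(\<Sum>a\<in>UNIV. w $ a * hess a p v) =
      (\<Sum>a\<in>UNIV. \<Sum>b\<in>UNIV. w $ a * v $ b * partial_diff a (partial_diff b \<phi>) p)"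
    "(\<Sum>b\<in>UNIV. hess b p w * v $ b) =
      (\<Sum>b\<in>UNIV. \<Sum>a\<in>UNIV. w $ a * v $ b * partial_diff a (partial_diff b \<phi>) p)"
    by (simp_all add: sum_distrib_left sum_distrib_right mult_ac)
  then show ?thesis by (simp only:) (rule sum.swap)
qed

lemma smooth_on_F_nth: "smooth_on P (\<lambda>p. F p $ b)"
  by (rule smooth_on_linear_compose[OF open_P bounded_linear_vec_nth smooth_F])

text \<open>Links \<open>deriv\<close> with \<open>frechet_derivative\<close>: the first fact feeds
  the chain rule, the second the smoothness of \<open>deriv \<Gamma>\<close>.\<close>

lemma has_derivative_Gamma:
  assumes "s \<in> J"
  shows "(\<Gamma> has_derivative (\<lambda>h. deriv \<Gamma> s * h)) (at s)"
    and "deriv \<Gamma> s = frechet_derivative \<Gamma> (at s) 1"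
proof -
  note d = smooth_on_has_derivative[OF smooth_Gamma assms]
  obtain D where D: "(\<Gamma> has_real_derivative D) (at s)"
    using has_real_derivative[OF d] by blast
  then have "deriv \<Gamma> s = D" by (rule DERIV_imp_deriv)
  with D show 1: "(\<Gamma> has_derivative (\<lambda>h. deriv \<Gamma> s * h)) (at s)"
    by (simp add: has_field_derivative_def)
  show "deriv \<Gamma> s = frechet_derivative \<Gamma> (at s) 1"
    using frechet_derivative_at[OF 1] by (metis mult.right_neutral)
qed

section \<open>Differentials of the adapted coordinates and of the Hamiltonian\<close>

lemma has_derivative_comp_proj:
  assumes "(f has_derivative f') (at (proj_p y))"
  shows "((\<lambda>y. f (proj_p y)) has_derivative (\<lambda>w. f' (proj_p w))) (at y)"
  using assms by (rule has_derivative_compose[OF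
      bounded_linear_imp_has_derivative[OF bounded_linear_proj_p]])

lemma has_derivative_fst_nth: "((\<lambda>y. fst y $ a) has_derivative (\<lambda>w. fst w $ a)) (at y)"
  by (intro bounded_linear_imp_has_derivative bounded_linear_compose[OF bounded_linear_vec_nth]
      bounded_linear_fst)

lemma has_derivative_Delta:
  assumes "y \<in> C"
  shows "(Delta \<phi> a has_derivative (\<lambda>w. fst w $ a - hess a (proj_p y) (proj_p w))) (at y)"
  unfolding Delta_eq
  by (intro has_derivative_diff has_derivative_fst_nth has_derivative_comp_proj
      has_derivative_partial_phi proj_in_P assms)

text \<open>This is \<open>d\<Delta>^0 = \<Delta>^a dp_a - \<lambda>\<close>: the coefficient of
  \<open>dp_a\<close> collects \<open>x^a\<close> and the partial derivative of \<phi> into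
  \<open>\<Delta>^a\<close>.\<close>

lemma has_derivative_Delta0:
  assumes "y \<in> C"
  shows "(Delta0 \<phi> has_derivative (\<lambda>w. (\<Sum>a\<in>UNIV. proj_p y $ a * fst w $ a)
      + (\<Sum>a\<in>UNIV. Delta \<phi> a y * proj_p w $ a) - snd (snd w))) (at y)"
proof -
  have "(Delta0 \<phi> has_derivative (\<lambda>w. (\<Sum>a\<in>UNIV. fst y $ a * proj_p w $ a + fst w $ a * proj_p y $ a)
      - (\<Sum>a\<in>UNIV. proj_p w $ a * partial_diff a \<phi> (proj_p y)) - snd (snd w))) (at y)"
    unfolding Delta0_eq
    by (intro has_derivative_diff has_derivative_sum has_derivative_mult has_derivative_fst_nth
        has_derivative_comp_proj[where f = \<phi>] smooth_on_has_derivative_partial_diff[OF smooth_phi] proj_in_P assms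
        has_derivative_comp_proj[where f = "\<lambda>p. p $ a" for a]
        bounded_linear_imp_has_derivative bounded_linear_vec_nth
        bounded_linear_compose[OF bounded_linear_snd bounded_linear_snd])
  then show ?thesis
    by (simp add: Delta_eq algebra_simps sum.distrib sum_subtractf)
qed

lemma has_derivative_lift_hamiltonian:
  assumes "y \<in> C"
  shows "(lift_hamiltonian \<phi> F \<Gamma> has_derivative (\<lambda>w.
    (\<Sum>b\<in>UNIV. Delta \<phi> b y * (\<Sum>a\<in>UNIV. proj_p w $ a * partial_diff a (\<lambda>p. F p $ b) (proj_p y))
      + (fst w $ b - hess b (proj_p y) (proj_p w)) * F (proj_p y) $ b)
    + deriv \<Gamma> (Delta0 \<phi> y) * ((\<Sum>a\<in>UNIV. proj_p y $ a * fst w $ a)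
      + (\<Sum>a\<in>UNIV. Delta \<phi> a y * proj_p w $ a) - snd (snd w)))) (at y)"
  unfolding lift_hamiltonian_def[abs_def]
  by (intro has_derivative_add has_derivative_sum has_derivative_mult has_derivative_Delta
      has_derivative_comp_proj[where f = "\<lambda>p. F p $ b" for b] smooth_on_has_derivative_partial_diff[OF smooth_on_F_nth] proj_in_P assms
      has_derivative_compose[OF has_derivative_Delta0 has_derivative_Gamma(1)])
    (use Delta0_C assms in auto)

text \<open>At each point the equations are a triangular linear system for the components
  \<open>(u, q, s)\<close> of \<open>X y\<close>: the equations for \<open>p\<close> fix
  \<open>q\<close>, then those for \<open>\<Delta>^a\<close> fix \<open>u\<close>, and the one for
  \<open>\<Delta>^0\<close> fixes \<open>s\<close>.\<close>

lemma lifted_equations_iff: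
  "lifted_equations C \<phi> F \<Gamma> X \<longleftrightarrow> (\<forall>y\<in>C. X y = lifted_vf \<phi> F \<Gamma> y)"
  unfolding lifted_equations_def
proof (intro ball_cong refl)
  fix y assume y: "y \<in> C"
  let ?p = "proj_p y"
  obtain u q s where X: "X y = (u, q, s)" by (cases "X y")
  have nth: "lie_derivative X (\<lambda>y. proj_p y $ a) y = q $ a" for a
  proof -
    have "((\<lambda>y. proj_p y $ a) has_derivative (\<lambda>w. proj_p w $ a)) (at y)"
      by (rule has_derivative_comp_proj[OF bounded_linear_imp_has_derivative[OF bounded_linear_vec_nth]])
    from frechet_derivative_at[OF this, symmetric] show ?thesis
      by (simp add: lie_derivative_def X proj_p_eq)
  qed
  have Da: "lie_derivative X (Delta \<phi> a) y = u $ a - hess a ?p q" for a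
    using frechet_derivative_at[OF has_derivative_Delta[OF y], symmetric]
    by (simp add: lie_derivative_def X proj_p_def)
  have D0: "lie_derivative X (Delta0 \<phi>) y =
      (\<Sum>a\<in>UNIV. ?p $ a * u $ a) + (\<Sum>a\<in>UNIV. Delta \<phi> a y * q $ a) - s"
    using frechet_derivative_at[OF has_derivative_Delta0[OF y], symmetric]
    by (simp add: lie_derivative_def X proj_p_def)
  show "((\<forall>a. lie_derivative X (Delta \<phi> a) y =
         - (\<Sum>b\<in>UNIV. partial_diff a (\<lambda>p. F p $ b) ?p * Delta \<phi> b y)
         - deriv \<Gamma> (Delta0 \<phi> y) * Delta \<phi> a y) \<and>
    (\<forall>a. lie_derivative X (\<lambda>y. proj_p y $ a) y = F ?p $ a) \<and>
    lie_derivative X (Delta0 \<phi>) y = - \<Gamma> (Delta0 \<phi> y)) \<longleftrightarrow> X y = lifted_vf \<phi> F \<Gamma> y"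
  \<comment> \<open>The remaining equations can be solved for \<open>u\<close> and \<open>s\<close>
    only once \<open>q\<close> is known; if \<open>q\<close> is wrong, both sides of the equivalence
    fail.\<close>
  proof (cases "q = F ?p")
    case True
    define U where "U = (\<chi> a. hess a ?p (F ?p)
      - (\<Sum>b\<in>UNIV. partial_diff a (\<lambda>p. F p $ b) ?p * Delta \<phi> b y)
      - deriv \<Gamma> (Delta0 \<phi> y) * Delta \<phi> a y)"
    have vf: "lifted_vf \<phi> F \<Gamma> y =
        (U, F ?p, (\<Sum>a\<in>UNIV. ?p $ a * U $ a) + lift_hamiltonian \<phi> F \<Gamma> y)"
      by (simp add: lifted_vf_def U_def Let_def)
    have "(\<forall>a. lie_derivative X (Delta \<phi> a) y =
         - (\<Sum>b\<in>UNIV. partial_diff a (\<lambda>p. F p $ b) ?p * Delta \<phi> b y)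
         - deriv \<Gamma> (Delta0 \<phi> y) * Delta \<phi> a y) \<longleftrightarrow> u = U"
      unfolding Da True by (auto simp: vec_eq_iff U_def algebra_simps)
    moreover have "lie_derivative X (Delta0 \<phi>) y = - \<Gamma> (Delta0 \<phi> y) \<longleftrightarrow>
        s = (\<Sum>a\<in>UNIV. ?p $ a * u $ a) + lift_hamiltonian \<phi> F \<Gamma> y"
      unfolding D0 True lift_hamiltonian_def by auto
    ultimately show ?thesis unfolding nth X vf using True by auto
  next
    case False
    then show ?thesis by (auto simp: nth X lifted_vf_def Let_def vec_eq_iff)
  qed
qed

section \<open>Smoothness of the Hamiltonian and of the lifted vector field\<close>

lemma smooth_on_Delta: "smooth_on C (Delta \<phi> a)"
  unfolding Delta_eq
  by (intro smooth_on_diff smooth_on_linear[OF open_C] open_C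
      smooth_on_compose[OF open_C open_P smooth_on_linear[OF open_C bounded_linear_proj_p]]
      smooth_on_partial_diff smooth_phi proj_C
      bounded_linear_compose[OF bounded_linear_vec_nth bounded_linear_fst])

lemma smooth_on_comp_proj: "smooth_on P f \<Longrightarrow> smooth_on C (\<lambda>y. f (proj_p y))"
  by (rule smooth_on_compose[OF open_C open_P smooth_on_linear[OF open_C bounded_linear_proj_p] _ proj_C])

lemma smooth_on_nth_proj: "smooth_on C (\<lambda>y. proj_p y $ a)"
  by (intro smooth_on_linear[OF open_C]
      bounded_linear_compose[OF bounded_linear_vec_nth bounded_linear_proj_p])

lemma smooth_on_Delta0: "smooth_on C (Delta0 \<phi>)"
  unfolding Delta0_eq
  by (intro smooth_on_diff smooth_on_sum smooth_on_mult smooth_on_nth_proj open_C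
      smooth_on_comp_proj smooth_phi smooth_on_linear[OF open_C]
      bounded_linear_compose[OF bounded_linear_vec_nth bounded_linear_fst]
      bounded_linear_compose[OF bounded_linear_snd bounded_linear_snd])

lemma smooth_on_lift_hamiltonian: "smooth_on C (lift_hamiltonian \<phi> F \<Gamma>)"
  unfolding lift_hamiltonian_def[abs_def]
  by (intro smooth_on_add smooth_on_sum smooth_on_mult smooth_on_Delta open_C
      smooth_on_comp_proj[OF smooth_on_F_nth]
      smooth_on_compose[OF open_C open_J smooth_on_Delta0 smooth_Gamma Delta0_C])

lemma smooth_on_lifted_vf: "smooth_on C (lifted_vf \<phi> F \<Gamma>)"
proof -
  \<comment> \<open>The direction \<open>F p\<close> moves with the base point, so the derivative is
    first expanded into second partial derivatives.\<close>
  have hess: "smooth_on P (\<lambda>p. hess a p (F p))" for a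
  proof (rule smooth_on_cong[OF open_P])
    show "smooth_on P (\<lambda>p. \<Sum>b\<in>UNIV. F p $ b * partial_diff b (partial_diff a \<phi>) p)"
      by (intro smooth_on_sum smooth_on_mult smooth_on_F_nth smooth_on_partial_diff smooth_phi open_P)
    show "(\<Sum>b\<in>UNIV. F p $ b * partial_diff b (partial_diff a \<phi>) p) = hess a p (F p)" if "p \<in> P" for p
      by (rule frechet_derivative_eq_sum_partial_diff[symmetric,
          OF differentiableI[OF has_derivative_partial_phi[OF that]]])
  qed
  have "smooth_on J (deriv \<Gamma>)"
    by (rule smooth_on_cong[OF open_J smooth_on_frechet_derivative[OF smooth_Gamma, of 1]])
      (simp add: has_derivative_Gamma)
  then have G: "smooth_on C (\<lambda>y. deriv \<Gamma> (Delta0 \<phi> y))"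
    by (rule smooth_on_compose[OF open_C open_J smooth_on_Delta0 _ Delta0_C])
  have u: "smooth_on C (\<lambda>y. hess a (proj_p y) (F (proj_p y))
      - (\<Sum>b\<in>UNIV. partial_diff a (\<lambda>p. F p $ b) (proj_p y) * Delta \<phi> b y)
      - deriv \<Gamma> (Delta0 \<phi> y) * Delta \<phi> a y)" for a
    by (intro smooth_on_diff smooth_on_sum smooth_on_mult smooth_on_Delta open_C G
        smooth_on_comp_proj[OF hess] smooth_on_comp_proj[OF smooth_on_partial_diff]
        smooth_on_F_nth)
  show ?thesis
    unfolding lifted_vf_def[abs_def] Let_def vec_lambda_beta
    by (intro smooth_on_Pair smooth_on_vec_lambda smooth_on_add smooth_on_sum smooth_on_mult u open_C
        smooth_on_comp_proj[OF smooth_F] smooth_on_nth_proj smooth_on_lift_hamiltonian)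
qed

section \<open>The contact Hamiltonian equations\<close>

lemma contact_hamiltonian_vf_lifted_vf:
  assumes "\<And>y. y \<in> C \<Longrightarrow> X y = lifted_vf \<phi> F \<Gamma> y"
  shows "contact_hamiltonian_vf C (lift_hamiltonian \<phi> F \<Gamma>) X"
  unfolding contact_hamiltonian_vf_def
proof (intro ballI conjI allI)
  fix y assume y: "y \<in> C"
  let ?p = "proj_p y" and ?X = "lifted_vf \<phi> F \<Gamma> y" and ?\<Gamma>' = "deriv \<Gamma> (Delta0 \<phi> y)"
  show "contact_form y (X y) = lift_hamiltonian \<phi> F \<Gamma> y"
    by (simp add: assms[OF y] contact_form_eq lifted_vf_def Let_def)
  fix w :: "'n contact_point"
  have pX: "proj_p ?X = F ?p" by (simp add: lifted_vf_def Let_def proj_p_def)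
  have uX: "fst ?X $ a = hess a ?p (F ?p)
      - (\<Sum>b\<in>UNIV. partial_diff a (\<lambda>p. F p $ b) ?p * Delta \<phi> b y) - ?\<Gamma>' * Delta \<phi> a y" for a
    by (simp add: lifted_vf_def Let_def)
  note dh = frechet_derivative_at[OF has_derivative_lift_hamiltonian[OF y], symmetric]
  have hess0: "hess b ?p 0 = 0" for b
    using has_derivative_bounded_linear[OF has_derivative_partial_phi[OF proj_in_P[OF y]]]
    by (rule linear_0[OF bounded_linear.linear])
  \<comment> \<open>\<open>h\<close> depends on \<open>z\<close> only through
    \<open>\<Delta>^0\<close>, whose derivative in \<open>z\<close> is -1.\<close>
  have R: "lie_derivative reeb (lift_hamiltonian \<phi> F \<Gamma>) y = - ?\<Gamma>'"
    unfolding lie_derivative_def dh by (simp add: reeb_def proj_p_eq[THEN fun_cong, of "(_, _, _)"] hess0)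
  \<comment> \<open>The transposed Jacobian of \<open>F\<close> in the components of
    \<open>X\<close>, paired with the \<open>p\<close>-part of \<open>w\<close>, becomes the
    derivative of \<open>F\<close> along \<open>w\<close>, which is how it occurs in
    \<open>dh\<close>.\<close>
  have swap: "(\<Sum>a\<in>UNIV. proj_p w $ a * (\<Sum>b\<in>UNIV. partial_diff a (\<lambda>p. F p $ b) ?p * Delta \<phi> b y))
      = (\<Sum>b\<in>UNIV. Delta \<phi> b y * (\<Sum>a\<in>UNIV. proj_p w $ a * partial_diff a (\<lambda>p. F p $ b) ?p))"
    unfolding sum_distrib_left by (subst sum.swap) (simp add: mult_ac)
  \<comment> \<open>Symmetry of the Hessian moves the argument \<open>F ?p\<close> outside, where it
    matches the factor of \<open>d\<Delta>^b\<close> in \<open>dh\<close>.\<close>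
  have wX: "(\<Sum>a\<in>UNIV. proj_p w $ a * fst ?X $ a) =
      (\<Sum>b\<in>UNIV. hess b ?p (proj_p w) * F ?p $ b)
      - (\<Sum>b\<in>UNIV. Delta \<phi> b y * (\<Sum>a\<in>UNIV. proj_p w $ a * partial_diff a (\<lambda>p. F p $ b) ?p))
      - ?\<Gamma>' * (\<Sum>a\<in>UNIV. Delta \<phi> a y * proj_p w $ a)"
    unfolding uX hess_symmetric[OF proj_in_P[OF y], symmetric] swap[symmetric]
    by (simp add: right_diff_distrib sum_subtractf sum_distrib_left mult_ac)
  \<comment> \<open>Since \<open>d\<Delta>^0\<close> contains \<open>-\<lambda>\<close>,
    \<open>dh\<close> contains \<open>-\<Gamma>' \<lambda>\<close>, which is
    \<open>(\<R>h) \<lambda>\<close> and cancels. The other terms agree with \<open>wX\<close> and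
    with the pairing of \<open>F\<close> with the \<open>x\<close>-part of \<open>w\<close>.\<close>
  show "exterior_derivative contact_form y (X y) w = - (frechet_derivative (lift_hamiltonian \<phi> F \<Gamma>) (at y) w
      - lie_derivative reeb (lift_hamiltonian \<phi> F \<Gamma>) y * contact_form y w)"
    unfolding assms[OF y] exterior_derivative_contact_form pX wX R dh contact_form_eq
    by (simp add: sum.distrib sum_subtractf left_diff_distrib right_diff_distrib distrib_left mult.commute)
qed

section \<open>The Legendre embedding, push-forwards and tangency\<close>

lemma has_derivative_legendre_embedding:
  assumes "p \<in> P"
  shows "(legendre_embedding \<phi> has_derivative
    (\<lambda>v. (\<chi> a. hess a p v, v, \<Sum>a\<in>UNIV. p $ a * hess a p v))) (at p)"
proof -
  have "(legendre_embedding \<phi> has_derivative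
    (\<lambda>v. (\<chi> a. hess a p v, v, (\<Sum>a\<in>UNIV. p $ a * hess a p v + v $ a * partial_diff a \<phi> p)
      - (\<Sum>a\<in>UNIV. v $ a * partial_diff a \<phi> p)))) (at p)"
    unfolding legendre_embedding_def[abs_def]
    by (intro has_derivative_Pair has_derivative_vec_lambda has_derivative_diff has_derivative_sum
        has_derivative_mult has_derivative_ident has_derivative_partial_phi smooth_on_has_derivative_partial_diff[OF smooth_phi] assms
        bounded_linear_imp_has_derivative bounded_linear_vec_nth)
  \<comment> \<open>Differentiating the factors \<open>p_a\<close> in the last component produces
    \<open>d\<phi>\<close>, which cancels against the derivative of \<open>-\<phi>\<close>. The
    result is annihilated by the contact form, so the image is indeed Legendre.\<close>
  then show ?thesis by (simp add: sum.distrib)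
qed

lemma smooth_on_legendre_embedding: "smooth_on P (legendre_embedding \<phi>)"
  unfolding legendre_embedding_def[abs_def]
  by (intro smooth_on_Pair smooth_on_vec_lambda smooth_on_diff smooth_on_sum smooth_on_mult
      smooth_on_partial_diff smooth_phi open_P smooth_on_linear[OF open_P] bounded_linear_ident
      bounded_linear_vec_nth)

lemma pushes_forward_legendre_embedding:
  assumes X: "\<And>y. y \<in> C \<Longrightarrow> X y = lifted_vf \<phi> F \<Gamma> y" and "\<Gamma> 0 = 0"
  shows "pushes_forward (legendre_embedding \<phi>) P F (restrict X (Delta_zero_locus \<phi> C))"
  unfolding pushes_forward_def
proof
  fix p assume p: "p \<in> P"
  let ?y = "legendre_embedding \<phi> p"
  \<comment> \<open>Membership in the zero locus makes all the \<Delta> vanish, and also ensures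
    that \<open>restrict\<close> returns the value of \<open>X\<close> there and not its
    default.\<close>
  have y: "?y \<in> C" "?y \<in> Delta_zero_locus \<phi> C"
    using p embed_P legendre_image_eq_Delta_zero_locus[OF proj_C embed_P] by blast+
  then have "Delta0 \<phi> ?y = 0" "Delta \<phi> a ?y = 0" for a
    by (auto simp: Delta_zero_locus_def)
  moreover have "proj_p ?y = p" by (simp add: legendre_embedding_def proj_p_def)
  ultimately have "lifted_vf \<phi> F \<Gamma> ?y = (\<chi> a. hess a p (F p), F p, \<Sum>a\<in>UNIV. p $ a * hess a p (F p))"
    by (simp add: lifted_vf_def lift_hamiltonian_def assms(2))
  then show "frechet_derivative (legendre_embedding \<phi>) (at p) (F p)
      = restrict X (Delta_zero_locus \<phi> C) ?y"
    using y X by (simp flip: frechet_derivative_at[OF has_derivative_legendre_embedding[OF p]])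
qed

lemma pushes_forward_proj_p:
  assumes "\<And>y. y \<in> C \<Longrightarrow> X y = lifted_vf \<phi> F \<Gamma> y"
  shows "pushes_forward proj_p C X F"
  unfolding pushes_forward_def
  frechet_derivative_at[OF bounded_linear_imp_has_derivative[OF bounded_linear_proj_p], symmetric]
  by (simp add: assms lifted_vf_def Let_def proj_p_eq)

end

text \<open>The image under \<open>f\<close> of the line through \<open>p\<close> in direction \<open>X p\<close> is a smooth curve with the
  required velocity, so no integral curve has to be constructed.\<close>

lemma tangent_to_image:
  fixes f :: "'a::euclidean_space \<Rightarrow> 'b::real_normed_vector"
  assumes "open S" "smooth_on S f" and push: "pushes_forward f S X Y"
  shows "tangent_to Y (f ` S)"
  unfolding tangent_to_def
proof
  fix y assume "y \<in> f ` S"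
  then obtain p where p: "p \<in> S" "y = f p" by blast
  define q where "q = (\<lambda>t::real. p + t *\<^sub>R X p)"
  have "open (q -` S)"
    unfolding q_def by (intro open_vimage assms(1) continuous_intros)
  moreover have "0 \<in> q -` S" using p by (simp add: q_def)
  ultimately obtain e where e: "e > 0" "ball 0 e \<subseteq> q -` S"
    using openE by blast
  have int: "{-e<..<e} = ball 0 e" by (auto simp: dist_real_def)
  have "smooth_on {-e<..<e} q"
    unfolding q_def
    by (intro smooth_on_add smooth_on_const smooth_on_linear bounded_linear_scaleR_left) auto
  then have c: "smooth_on {-e<..<e} (\<lambda>t. f (q t))"
    using e(2) by (intro smooth_on_compose[OF _ assms(1) _ assms(2)]) (auto simp: int)
  have D: "(f has_derivative frechet_derivative f (at p)) (at (q 0))"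
    using smooth_on_has_derivative[OF assms(2) p(1)] by (simp add: q_def)
  have "(q has_derivative (\<lambda>h. h *\<^sub>R X p)) (at 0)"
    unfolding q_def by (auto intro!: derivative_eq_intros)
  from has_derivative_compose[OF this D]
  have "((\<lambda>t. f (q t)) has_vector_derivative Y y) (at 0)"
    using push p
    by (simp add: has_vector_derivative_def pushes_forward_def
        linear_simps(5)[OF has_derivative_bounded_linear[OF D]])
  with c e show "Y y \<in> tangent_vectors (f ` S) y"
    unfolding tangent_vectors_def
    by (intro CollectI exI[of _ "\<lambda>t. f (q t)"] exI[of _ e]) (auto simp: int p(2) q_def)
qed

text \<open>Existence is asserted separately so that the statement about all smooth solutions is not
  vacuous. By \<open>lifted_equations_iff\<close> a solution is unique on \<open>C\<close>; only its
  values there matter.\<close>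

theorem proposition4p2:
  fixes C :: "'n::finite contact_point set"
    and P :: "(real^'n) set" and J :: "real set"
    and \<phi> :: "real^'n \<Rightarrow> real" and F :: "real^'n \<Rightarrow> real^'n" and \<Gamma> :: "real \<Rightarrow> real"
  assumes "open C" and "open P" and "open J"
    and "proj_p ` C \<subseteq> P" and "legendre_embedding \<phi> ` P \<subseteq> C" and "Delta0 \<phi> ` C \<subseteq> J"
    and "smooth_on P \<phi>" and "smooth_on P F" and "smooth_on J \<Gamma>"
    and "\<exists>p\<in>P. F p \<noteq> 0"
  shows "(\<exists>X. smooth_on C X \<and> lifted_equations C \<phi> F \<Gamma> X) \<and>
    (\<forall>X. smooth_on C X \<and> lifted_equations C \<phi> F \<Gamma> X \<longrightarrow>
       flow_lift proj_p C X P F \<and>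
       contact_hamiltonian_vf C (lift_hamiltonian \<phi> F \<Gamma>) X \<and>
       (\<Gamma> 0 = 0 \<and> (\<forall>s\<in>J. s \<noteq> 0 \<longrightarrow> \<Gamma> s \<noteq> 0) \<longrightarrow>
          (let X0 = restrict X (Delta_zero_locus \<phi> C) in
             tangent_to X0 (legendre_embedding \<phi> ` P) \<and>
             pushes_forward proj_p C X F \<and>
             pushes_forward (legendre_embedding \<phi>) P F X0)))"
proof -
  interpret legendre_lift C P J \<phi> F \<Gamma>
    using assms by unfold_locales
  show ?thesis
  proof (intro conjI allI impI exI[of _ "lifted_vf \<phi> F \<Gamma>"])
    show "smooth_on C (lifted_vf \<phi> F \<Gamma>)" by (rule smooth_on_lifted_vf)
    show "lifted_equations C \<phi> F \<Gamma> (lifted_vf \<phi> F \<Gamma>)" by (simp add: lifted_equations_iff)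
    fix X assume "smooth_on C X \<and> lifted_equations C \<phi> F \<Gamma> X"
    then have smooth: "smooth_on C X" and X: "\<And>y. y \<in> C \<Longrightarrow> X y = lifted_vf \<phi> F \<Gamma> y"
      by (auto simp: lifted_equations_iff)
    show "flow_lift proj_p C X P F"
    proof (rule flow_liftI[OF open_C smooth open_P smooth_F proj_image _ bounded_linear_proj_p])
      show "DIM(real^'n) < DIM('n contact_point)" by simp
      show "proj_p (X y) = F (proj_p y)" if "y \<in> C" for y
        by (simp add: X[OF that] lifted_vf_def Let_def proj_p_def)
    qed
    show "contact_hamiltonian_vf C (lift_hamiltonian \<phi> F \<Gamma>) X"
      using X by (rule contact_hamiltonian_vf_lifted_vf)
    assume "\<Gamma> 0 = 0 \<and> (\<forall>s\<in>J. s \<noteq> 0 \<longrightarrow> \<Gamma> s \<noteq> 0)"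
    then have push: "pushes_forward (legendre_embedding \<phi>) P F (restrict X (Delta_zero_locus \<phi> C))"
      using X by (intro pushes_forward_legendre_embedding) auto
    \<comment> \<open>Tangency follows from the push-forward identity: at each point of the image,
      the restricted field is the derivative of the embedding applied to \<open>F\<close>.\<close>
    show "let X0 = restrict X (Delta_zero_locus \<phi> C) in
        tangent_to X0 (legendre_embedding \<phi> ` P) \<and> pushes_forward proj_p C X F \<and>
        pushes_forward (legendre_embedding \<phi>) P F X0"
      unfolding Let_def
      by (intro conjI tangent_to_image[OF open_P smooth_on_legendre_embedding push] push
          pushes_forward_proj_p X)
  qed
qed

end
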